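(* Let $n$ be a nonnegative integer, $I\subseteq[n-1]$, and let $\nu>1$ be an integer. Then $\mathrm{ch}_\nu(\mathbb G_I(\nu))=G_I(\nu)$, where $G_I(\nu)$ is the specialization at $q=\nu$ of the quasisymmetric Hall--Littlewood function $G_I(q)=G_{\mathrm{comp}(I)}(q)$.
   Context: Notation: $[k]=\{1,\dots,k\}$ for $k\ge1$ and $[k]=\emptyset$ for $k\le 0$. For $n\ge1$, $I=\{s_1<\dots<s_i\}\subseteq[n-1]$ corresponds to the composition $\mathrm{comp}(I)=(s_1,s_2-s_1,\dots,n-s_i)$ of $n$; for $n=0$ it is the empty composition. $L_I=L_{\mathrm{comp}(I)}=\sum_{I\subseteq J\subseteq[n-1]}M_{\mathrm{comp}(J)}$ is the fundamental quasisymmetric function, where $M_\alpha=\sum_{i_1<\dots<i_l}x_{i_1}^{\alpha_1}\cdots x_{i_l}^{\alpha_l}$. For $I\subseteq[n-1]$ the weight function is $\mathrm{wt}_I(i)=|[1,i-1]\cap I|+1$ for $i\in[n-1]$. Hivert's quasisymmetric Hall--Littlewood function is given by $$G_I(q)=\sum_{I\subseteq J\subseteq[n-1]}(-1)^{|J\setminus I|}q^{s(I,J)}L_J,\qquad s(I,J)=\sum_{i\in J\setminus I}\mathrm{wt}_I(i).$$ Let $C_\nu$ be a cyclic group of order $\nu$, written additively, $Q_n(\nu)=\bigoplus_{i\in[n-1]}C_\nu$ (trivial if $n\le 1$). Let $\mathrm{scf}(\mathcal N_n(\nu))$ be the space of complex functions on $Q_n(\nu)$ constant on each set $\{g: g_i\ne0\iff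 i\in I\}$, $I\subseteq[n-1]$. Let $\mathbb 1$, $\mathbb{reg}$ be the trivial and regular characters of $C_\nu$ and $\overline{\mathbb{reg}}=(\mathbb{reg}-\mathbb 1)/(\nu-1)$. For functions $\phi_i$ on $C_\nu$ ($i\in[n-1]$), $[(\phi_i)_i]$ denotes the function $g\mapsto\prod_i\phi_i(g_i)$ on $Q_n(\nu)$. The functions $\dot\chi^I(\nu)=[(\phi_i)_i]$ with $\phi_i=\mathbb 1$ for $i\in I$ and $\phi_i=\overline{\mathbb{reg}}$ for $i\notin I$ (the normalized supercharacters) form a basis of $\mathrm{scf}(\mathcal N_n(\nu))$, and $\mathrm{ch}_\nu$ is the linear isomorphism with $\mathrm{ch}_\nu(\dot\chi^I(\nu))=L_{\mathrm{comp}(I)}$. The function $\mathbb G_I(\nu)=[(\mathbb G_I(\nu)_i)_{i\in[n-1]}]$ has components $\mathbb G_I(\nu)_i=\mathbb 1$ if $i\in I$ and $\mathbb G_I(\nu)_i=\overline{\mathbb{reg}}-\nu^{\mathrm{wt}_I(i)}\mathbb 1$ if $i\in[n-1]\setminus I$. *)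

theory Defs
  imports "HOL-Algebra.Product_Groups" "HOL-Algebra.Coset" "HOL-Library.Poly_Mapping"
    "HOL-Computational_Algebra.Polynomial"
begin

section \<open>Quasisymmetric functions\<close>

text \<open>
  A monomial in the ordered variables \<open>x\<^sub>1, x\<^sub>2, \<dots>\<close> is a finitely supported exponent function; its
  argument \<open>i\<close> stands for the variable \<open>x\<^sub>i\<^sub>+\<^sub>1\<close>.  A formal power series is its coefficient function.
  The set \<open>[n - 1]\<close> is \<open>{1..n - 1}\<close>, which is empty for \<open>n \<le> 1\<close> by truncated subtraction.
\<close>

type_synonym mono = "nat \<Rightarrow>\<^sub>0 nat"
type_synonym 'k series = "mono \<Rightarrow> 'k"

fun differences :: "nat \<Rightarrow> nat list \<Rightarrow> nat list" where
  "differences p [] = []"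
| "differences p (s # ss) = (s - p) # differences s ss"

definition composition_of :: "nat \<Rightarrow> nat set \<Rightarrow> nat list" where
  "composition_of n I = (if n = 0 then [] else differences 0 (sorted_list_of_set I @ [n]))"

definition monomial_of :: "nat list \<Rightarrow> nat list \<Rightarrow> mono" where
  "monomial_of is \<alpha> = sum_list (map2 Poly_Mapping.single is \<alpha>)"

text \<open>
  The coefficient of \<open>m\<close> in \<open>M\<^sub>\<alpha>\<close> is the number of index sequences \<open>i\<^sub>1 < \<dots> < i\<^sub>l\<close> whose summand is
  \<open>m\<close>.  That number is finite when, as in a composition, all parts of \<open>\<alpha>\<close> are positive.
\<close>

definition monomial_qsym :: "nat list \<Rightarrow> 'k::comm_semiring_1 series" where
  "monomial_qsym \<alpha> = (\<lambda>m. of_nat (card {is. length is = length \<alpha> \<and> sorted_wrt (<) is \<and>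
     monomial_of is \<alpha> = m}))"

definition fundamental_qsym :: "nat \<Rightarrow> nat set \<Rightarrow> 'k::comm_semiring_1 series" where
  "fundamental_qsym n I = (\<lambda>m. \<Sum>J | I \<subseteq> J \<and> J \<subseteq> {1..n - 1}. monomial_qsym (composition_of n J) m)"

text \<open>The homogeneous component of degree \<open>n\<close> over \<open>\<complex>\<close>.\<close>

definition QSym :: "nat \<Rightarrow> complex series set" where
  "QSym n = {(\<lambda>m. \<Sum>J\<in>Pow {1..n - 1}. c J * monomial_qsym (composition_of n J) m) | c. True}"

definition wt :: "nat set \<Rightarrow> nat \<Rightarrow> nat" where
  "wt I i = card ({1..i - 1} \<inter> I) + 1"

definition hivert_exponent :: "nat set \<Rightarrow> nat set \<Rightarrow> nat" where
  "hivert_exponent I J = (\<Sum>i\<in>J - I. wt I i)"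

text \<open>\<open>G\<^sub>I(q)\<close> has coefficients in \<open>\<complex>[q]\<close>; \<open>Polynomial.monom 1 k\<close> is \<open>q\<^sup>k\<close>.\<close>

definition hall_littlewood :: "nat \<Rightarrow> nat set \<Rightarrow> complex poly series" where
  "hall_littlewood n I = (\<lambda>m. \<Sum>J | I \<subseteq> J \<and> J \<subseteq> {1..n - 1}.
     (- 1) ^ card (J - I) * Polynomial.monom 1 (hivert_exponent I J) * fundamental_qsym n J m)"

definition specialize :: "complex \<Rightarrow> complex poly series \<Rightarrow> complex series" where
  "specialize q F = (\<lambda>m. poly (F m) q)"


section \<open>Superclass functions on \<open>Q\<^sub>n(\<nu>)\<close>\<close>

text \<open>
  Throughout, \<open>C\<close> is a cyclic group of order \<open>\<nu> = Coset.order C\<close>.  Its operation is written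
  multiplicatively, so \<open>\<one>\<^bsub>C\<^esub>\<close> is the element \<open>0\<close> of the additive notation.
\<close>

definition Q :: "nat \<Rightarrow> 'a monoid \<Rightarrow> (nat \<Rightarrow> 'a) monoid" where
  "Q n C = sum_group {1..n - 1} (\<lambda>_. C)"

text \<open>Functions on \<open>Q n C\<close> are extensional, so that equality is equality on the carrier.\<close>

definition scf :: "nat \<Rightarrow> 'a monoid \<Rightarrow> ((nat \<Rightarrow> 'a) \<Rightarrow> complex) set" where
  "scf n C = {f \<in> extensional (carrier (Q n C)).
     \<forall>A \<subseteq> {1..n - 1}. \<exists>c. \<forall>g \<in> carrier (Q n C).
       (\<forall>i \<in> {1..n - 1}. g i \<noteq> \<one>\<^bsub>C\<^esub> \<longleftrightarrow> i \<in> A) \<longrightarrow> f g = c}"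

definition tensor :: "nat \<Rightarrow> 'a monoid \<Rightarrow> (nat \<Rightarrow> 'a \<Rightarrow> complex) \<Rightarrow> (nat \<Rightarrow> 'a) \<Rightarrow> complex" where
  "tensor n C \<phi> = (\<lambda>g \<in> carrier (Q n C). \<Prod>i\<in>{1..n - 1}. \<phi> i (g i))"

definition triv_char :: "'a \<Rightarrow> complex" where
  "triv_char x = 1"

text \<open>The trace of left translation by \<open>x\<close> on the group algebra.\<close>

definition reg_char :: "'a monoid \<Rightarrow> 'a \<Rightarrow> complex" where
  "reg_char C x = of_nat (card {h \<in> carrier C. x \<otimes>\<^bsub>C\<^esub> h = h})"

definition reg_bar :: "'a monoid \<Rightarrow> 'a \<Rightarrow> complex" where
  "reg_bar C x = (reg_char C x - triv_char x) / (of_nat (Coset.order C) - 1)"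

definition nsupchar :: "nat \<Rightarrow> 'a monoid \<Rightarrow> nat set \<Rightarrow> (nat \<Rightarrow> 'a) \<Rightarrow> complex" where
  "nsupchar n C I = tensor n C (\<lambda>i. if i \<in> I then triv_char else reg_bar C)"

definition hl_function :: "nat \<Rightarrow> 'a monoid \<Rightarrow> nat set \<Rightarrow> (nat \<Rightarrow> 'a) \<Rightarrow> complex" where
  "hl_function n C I = tensor n C (\<lambda>i. if i \<in> I then triv_char
     else (\<lambda>x. reg_bar C x - of_nat (Coset.order C) ^ wt I i * triv_char x))"

definition is_ch :: "nat \<Rightarrow> 'a monoid \<Rightarrow> (((nat \<Rightarrow> 'a) \<Rightarrow> complex) \<Rightarrow> complex series) \<Rightarrow> bool" where
  "is_ch n C T \<longleftrightarrow>
     T \<in> extensional (scf n C) \<and>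
     (\<forall>f \<in> scf n C. \<forall>h \<in> scf n C. \<forall>a b.
        T (\<lambda>g \<in> carrier (Q n C). a * f g + b * h g) = (\<lambda>m. a * T f m + b * T h m)) \<and>
     bij_betw T (scf n C) (QSym n) \<and>
     (\<forall>I \<subseteq> {1..n - 1}. T (nsupchar n C I) = fundamental_qsym n I)"

text \<open>Existence and uniqueness of this isomorphism are proved in \<open>ex1_is_ch\<close> below.\<close>

definition ch :: "nat \<Rightarrow> 'a monoid \<Rightarrow> ((nat \<Rightarrow> 'a) \<Rightarrow> complex) \<Rightarrow> complex series" where
  "ch n C = (THE T. is_ch n C T)"


section \<open>Well-definedness of \<open>ch\<close>\<close>

subsection \<open>The fundamental functions form a basis\<close>

lemma differences_inj:
  assumes "sorted_wrt (<) (p # s)" "sorted_wrt (<) (p # t)" "differences p s = differences p t"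
  shows "s = t"
  using assms
proof (induction s arbitrary: p t)
  case Nil then show ?case by (cases t) auto
next
  case (Cons a s)
  then obtain b t' where t: "t = b # t'" by (cases t) auto
  have "a - p = b - p" "p < a" "p < b" using Cons.prems t by auto
  then have "a = b" by linarith
  then show ?case using Cons.IH[of a t'] Cons.prems t by auto
qed

lemma differences_pos: "sorted_wrt (<) (p # s) \<Longrightarrow> x \<in> set (differences p s) \<Longrightarrow> 0 < x"
  by (induction s arbitrary: p) auto

lemma sorted_comp:
  fixes n :: nat
  assumes "I \<subseteq> {1..n - 1}" "n \<noteq> 0"
  shows "sorted_wrt (<) (0 # sorted_list_of_set I @ [n])"
proof -
  have "finite I" by (rule finite_subset[OF assms(1) finite_atLeastAtMost])
  moreover have "0 < i \<and> i < n" if "i \<in> I" for i using subsetD[OF assms(1) that] assms(2) by auto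
  ultimately show ?thesis using assms(2)
    by (auto simp: sorted_wrt_append)
qed

lemma comp_inj:
  assumes "I \<subseteq> {1..n - 1}" "J \<subseteq> {1..n - 1}" "composition_of n I = composition_of n J"
  shows "I = J"
proof (cases "n = 0")
  case True then show ?thesis using assms by auto
next
  case False
  have "sorted_list_of_set I @ [n] = sorted_list_of_set J @ [n]"
    using differences_inj[OF sorted_comp sorted_comp] assms False by (auto simp: composition_of_def)
  moreover have "finite I" "finite J" using assms finite_subset by blast+
  ultimately show ?thesis by (metis append_same_eq set_sorted_list_of_set)
qed

lemma comp_pos: "I \<subseteq> {1..n - 1} \<Longrightarrow> x \<in> set (composition_of n I) \<Longrightarrow> 0 < x"
  using differences_pos[OF sorted_comp] by (auto simp: composition_of_def split: if_splits)

lemma lookup_monomial_of_notin: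
  "i \<notin> set is \<Longrightarrow> Poly_Mapping.lookup (monomial_of is \<alpha>) i = 0"
proof (induction "is" arbitrary: \<alpha>)
  case Nil then show ?case by (simp add: monomial_of_def)
next
  case (Cons j js)
  then show ?case
    by (cases \<alpha>) (auto simp: monomial_of_def lookup_add lookup_single)
qed

lemma lookup_monomial_of:
  "length is = length \<alpha> \<Longrightarrow> distinct is \<Longrightarrow> k < length is \<Longrightarrow>
    Poly_Mapping.lookup (monomial_of is \<alpha>) (is ! k) = \<alpha> ! k"
proof (induction "is" arbitrary: \<alpha> k)
  case Nil then show ?case by simp
next
  case (Cons j js)
  then obtain a \<beta> where \<alpha>: "\<alpha> = a # \<beta>" by (cases \<alpha>) auto
  have split: "monomial_of (j # js) (a # \<beta>) = Poly_Mapping.single j a + monomial_of js \<beta>"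
    by (simp add: monomial_of_def)
  show ?case
  proof (cases k)
    case 0
    then show ?thesis using Cons.prems
      by (simp add: split lookup_add lookup_monomial_of_notin \<alpha>)
  next
    case (Suc k')
    then have "js ! k' \<in> set js" using Cons.prems by simp
    then have "j \<noteq> js ! k'" using Cons.prems by auto
    then show ?thesis using Suc Cons.prems Cons.IH[of \<beta> k']
      by (simp add: split lookup_add lookup_single \<alpha>)
  qed
qed

lemma monomial_of_inj:
  assumes "length is = length \<alpha>" "length js = length \<beta>" "sorted_wrt (<) is" "sorted_wrt (<) js"
    and pos: "\<And>x. x \<in> set \<alpha> \<Longrightarrow> 0 < x" "\<And>x. x \<in> set \<beta> \<Longrightarrow> 0 < x"
    and eq: "monomial_of is \<alpha> = monomial_of js \<beta>"
  shows "is = js \<and> \<alpha> = \<beta>"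
proof -
  have d: "distinct is" "distinct js" using assms strict_sorted_iff by blast+
  have keys: "set ks = {i. Poly_Mapping.lookup (monomial_of ks \<gamma>) i \<noteq> 0}"
    if "length ks = length \<gamma>" "distinct ks" "\<And>x. x \<in> set \<gamma> \<Longrightarrow> 0 < x" for ks \<gamma>
  proof -
    have "Poly_Mapping.lookup (monomial_of ks \<gamma>) i \<noteq> 0" if "i \<in> set ks" for i
      using that lookup_monomial_of[of ks \<gamma>] \<open>length ks = length \<gamma>\<close> \<open>distinct ks\<close>
        \<open>\<And>x. x \<in> set \<gamma> \<Longrightarrow> 0 < x\<close>
      by (metis in_set_conv_nth less_numeral_extra(3))
    then show ?thesis using lookup_monomial_of_notin[of _ ks \<gamma>] by (auto; metis less_irrefl)
  qed
  have "set is = set js"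
    using keys[OF assms(1) d(1) pos(1)] keys[OF assms(2) d(2) pos(2)] eq by (simp only:)
  then have ij: "is = js" using assms by (simp add: strict_sorted_equal)
  have "\<alpha> = \<beta>"
  proof (rule nth_equalityI)
    show "length \<alpha> = length \<beta>" using assms(1,2) ij by simp
    show "\<alpha> ! k = \<beta> ! k" if "k < length \<alpha>" for k
      using lookup_monomial_of[OF assms(1) d(1), of k] lookup_monomial_of[OF assms(2) d(2), of k]
        that assms(1,2) ij eq by simp
  qed
  with ij show ?thesis by simp
qed

lemma monomial_qsym_coeff:
  assumes "J \<subseteq> {1..n - 1}" "K \<subseteq> {1..n - 1}"
  defines "\<alpha> \<equiv> composition_of n J"
  shows "monomial_qsym (composition_of n K) (monomial_of [0..<length \<alpha>] \<alpha>) =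
    (if K = J then 1 else (0 :: 'k::comm_semiring_1))"
proof -
  let ?S = "{is. length is = length (composition_of n K) \<and> sorted_wrt (<) is \<and>
    monomial_of is (composition_of n K) = monomial_of [0..<length \<alpha>] \<alpha>}"
  have *: "is = [0..<length \<alpha>] \<and> composition_of n K = \<alpha>" if "is \<in> ?S" for "is"
    using that monomial_of_inj[of "is" "composition_of n K" "[0..<length \<alpha>]" \<alpha>] comp_pos assms by auto
  show ?thesis
  proof (cases "K = J")
    case True
    then have "?S = {[0..<length \<alpha>]}" using * by (auto simp: \<alpha>_def)
    then show ?thesis using True by (simp add: monomial_qsym_def)
  next
    case False
    then have "?S = {}" using * comp_inj assms by blast
    then show ?thesis using False unfolding monomial_qsym_def by (simp only: card.empty of_nat_0 if_False)
  qed
qed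

lemma sum_fundamental:
  fixes b :: "nat set \<Rightarrow> complex"
  shows "(\<Sum>I\<in>Pow {1..n - 1}. b I * fundamental_qsym n I m) =
    (\<Sum>J\<in>Pow {1..n - 1}. sum b (Pow J) * monomial_qsym (composition_of n J) m)"
proof -
  let ?X = "Pow {1..n - 1}" and ?M = "\<lambda>J. monomial_qsym (composition_of n J) m"
  have "(\<Sum>I\<in>?X. b I * fundamental_qsym n I m) = (\<Sum>I\<in>?X. \<Sum>J\<in>?X. if I \<subseteq> J then b I * ?M J else 0)"
    by (intro sum.cong refl, simp add: fundamental_qsym_def sum_distrib_left, intro sum.mono_neutral_cong_left)
       auto
  also have "\<dots> = (\<Sum>J\<in>?X. \<Sum>I\<in>?X. if I \<subseteq> J then b I * ?M J else 0)"
    by (rule sum.swap)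
  also have "\<dots> = (\<Sum>J\<in>?X. sum b (Pow J) * ?M J)"
    by (intro sum.cong refl, simp add: sum_distrib_right, intro sum.mono_neutral_cong_right) auto
  finally show ?thesis .
qed

lemma sum_monomial_coeff:
  fixes c :: "nat set \<Rightarrow> complex"
  assumes "J \<subseteq> {1..n - 1}"
  shows "(\<Sum>K\<in>Pow {1..n - 1}. c K *
    monomial_qsym (composition_of n K) (monomial_of [0..<length (composition_of n J)] (composition_of n J))) = c J"
proof -
  have "(\<Sum>K\<in>Pow {1..n - 1}. c K *
      monomial_qsym (composition_of n K) (monomial_of [0..<length (composition_of n J)] (composition_of n J))) =
    (\<Sum>K\<in>Pow {1..n - 1}. if K = J then c K else 0)"
    by (intro sum.cong refl) (auto simp: monomial_qsym_coeff[OF assms])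
  then show ?thesis using assms by simp
qed

lemma fundamental_independent:
  fixes a b :: "nat set \<Rightarrow> complex"
  assumes eq: "(\<lambda>m. \<Sum>I\<in>Pow {1..n - 1}. a I * fundamental_qsym n I m) =
      (\<lambda>m. \<Sum>I\<in>Pow {1..n - 1}. b I * fundamental_qsym n I m)"
    and "J \<subseteq> {1..n - 1}"
  shows "a J = b J"
proof -
  have S: "sum a (Pow K) = sum b (Pow K)" if "K \<subseteq> {1..n - 1}" for K
    using fun_cong[OF eq, of "monomial_of [0..<length (composition_of n K)] (composition_of n K)"]
    unfolding sum_fundamental sum_monomial_coeff[OF that] .
  have fin: "finite J" using assms finite_subset by blast
  have "a J = (\<Sum>T\<in>Pow J. (- 1) ^ (card J - card T) * sum a (Pow T))"
    by (rule inclusion_exclusion_mobius) (use fin in auto)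
  also have "\<dots> = (\<Sum>T\<in>Pow J. (- 1) ^ (card J - card T) * sum b (Pow T))"
    using S assms(2) by (intro sum.cong) auto
  also have "\<dots> = b J"
    by (rule inclusion_exclusion_mobius[symmetric]) (use fin in auto)
  finally show ?thesis .
qed

lemma QSym_fundamental:
  "QSym n = {(\<lambda>m. \<Sum>I\<in>Pow {1..n - 1}. b I * fundamental_qsym n I m) | b. True}"
proof -
  have "\<exists>b. (\<lambda>m. \<Sum>J\<in>Pow {1..n - 1}. c J * monomial_qsym (composition_of n J) m) =
      (\<lambda>m. \<Sum>I\<in>Pow {1..n - 1}. b I * fundamental_qsym n I m)" for c :: "nat set \<Rightarrow> complex"
  proof -
    define g where "g = (\<lambda>S. \<Sum>T\<in>Pow S. (- 1) ^ card T * c T)"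
    define b where "b = (\<lambda>T. (- 1) ^ card T * g T)"
    have "c J = sum b (Pow J)" if "J \<subseteq> {1..n - 1}" for J
      unfolding b_def
      by (rule inclusion_exclusion_symmetric) (use that finite_subset in \<open>auto simp: g_def\<close>)
    then have "(\<lambda>m. \<Sum>J\<in>Pow {1..n - 1}. c J * monomial_qsym (composition_of n J) m) =
      (\<lambda>m. \<Sum>I\<in>Pow {1..n - 1}. b I * fundamental_qsym n I m)"
      unfolding sum_fundamental by (intro ext sum.cong) auto
    then show ?thesis by blast
  qed
  moreover have "\<exists>c. (\<lambda>m. \<Sum>I\<in>Pow {1..n - 1}. b I * fundamental_qsym n I m) =
      (\<lambda>m. \<Sum>J\<in>Pow {1..n - 1}. c J * monomial_qsym (composition_of n J) m)" for b :: "nat set \<Rightarrow> complex"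
    by (rule exI[of _ "\<lambda>J. sum b (Pow J)"]) (simp only: sum_fundamental)
  ultimately show ?thesis unfolding QSym_def by blast
qed


subsection \<open>The normalized supercharacters form a basis\<close>

lemma carrier_Q: "group C \<Longrightarrow> carrier (Q n C) = {1..n - 1} \<rightarrow>\<^sub>E carrier C"
  by (auto simp: Q_def carrier_sum_group)

lemma reg_bar_eq:
  assumes "group C" "1 < Coset.order C" "x \<in> carrier C"
  shows "reg_bar C x = (if x = \<one>\<^bsub>C\<^esub> then 1 else - 1 / (of_nat (Coset.order C) - 1))"
proof -
  interpret group C by fact
  have "{h \<in> carrier C. x \<otimes>\<^bsub>C\<^esub> h = h} = (if x = \<one>\<^bsub>C\<^esub> then carrier C else {})"
    using assms(3) by (auto simp: r_cancel_one')
  then show ?thesis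
    using assms(2) by (auto simp: reg_bar_def reg_char_def triv_char_def Coset.order_def)
qed

lemma nsupchar_scf:
  assumes "group C" "1 < Coset.order C"
  shows "nsupchar n C I \<in> scf n C"
proof -
  have "\<exists>c. \<forall>g \<in> carrier (Q n C).
       (\<forall>i \<in> {1..n - 1}. g i \<noteq> \<one>\<^bsub>C\<^esub> \<longleftrightarrow> i \<in> A) \<longrightarrow> nsupchar n C I g = c" for A
  proof (intro exI ballI impI)
    fix g assume g: "g \<in> carrier (Q n C)" "\<forall>i \<in> {1..n - 1}. g i \<noteq> \<one>\<^bsub>C\<^esub> \<longleftrightarrow> i \<in> A"
    have gi: "g i \<in> carrier C" if "i \<in> {1..n - 1}" for i
      using g that by (auto simp: carrier_Q[OF assms(1)])
    show "nsupchar n C I g = (\<Prod>i\<in>{1..n - 1}. if i \<in> I then 1 else if i \<notin> A then 1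
        else - 1 / (of_nat (Coset.order C) - 1))"
      unfolding nsupchar_def tensor_def restrict_apply'[OF g(1)]
      using g(2) by (intro prod.cong refl) (auto simp: triv_char_def reg_bar_eq[OF assms gi])
  qed
  then show ?thesis by (auto simp: scf_def nsupchar_def tensor_def)
qed

lemma sum_restrict_scf:
  assumes "\<And>I. I \<in> X \<Longrightarrow> F I \<in> scf n C"
  shows "(\<lambda>g \<in> carrier (Q n C). \<Sum>I\<in>X. a I * F I g) \<in> scf n C"
proof -
  have "\<exists>c. \<forall>g \<in> carrier (Q n C).
       (\<forall>i \<in> {1..n - 1}. g i \<noteq> \<one>\<^bsub>C\<^esub> \<longleftrightarrow> i \<in> A) \<longrightarrow>
       (\<lambda>g \<in> carrier (Q n C). \<Sum>I\<in>X. a I * F I g) g = c" if A: "A \<subseteq> {1..n - 1}" for A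
  proof -
    have "\<forall>I\<in>X. \<exists>c. \<forall>g \<in> carrier (Q n C).
       (\<forall>i \<in> {1..n - 1}. g i \<noteq> \<one>\<^bsub>C\<^esub> \<longleftrightarrow> i \<in> A) \<longrightarrow> F I g = c"
      using assms A by (auto simp: scf_def)
    then obtain c where "\<forall>I\<in>X. \<forall>g \<in> carrier (Q n C).
       (\<forall>i \<in> {1..n - 1}. g i \<noteq> \<one>\<^bsub>C\<^esub> \<longleftrightarrow> i \<in> A) \<longrightarrow> F I g = c I"
      by metis
    then show ?thesis by (intro exI[of _ "\<Sum>I\<in>X. a I * c I"]) (auto intro!: sum.cong)
  qed
  then show ?thesis by (auto simp: scf_def)
qed

lemma scf_span:
  assumes "group C" "1 < Coset.order C" "f \<in> scf n C"
  shows "\<exists>a. f = (\<lambda>g \<in> carrier (Q n C). \<Sum>I\<in>Pow {1..n - 1}. a I * nsupchar n C I g)"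
proof -
  let ?N = "{1..n - 1}"
  let ?\<nu> = "of_nat (Coset.order C) :: complex"
  have \<nu>: "?\<nu> \<noteq> 0" "?\<nu> \<noteq> 1" using assms(2) by auto
  have "\<forall>A \<in> Pow ?N. \<exists>c. \<forall>g \<in> carrier (Q n C). (\<forall>i \<in> ?N. g i \<noteq> \<one>\<^bsub>C\<^esub> \<longleftrightarrow> i \<in> A) \<longrightarrow> f g = c"
    using assms(3) by (auto simp: scf_def)
  then obtain v where v: "\<And>A g. A \<subseteq> ?N \<Longrightarrow> g \<in> carrier (Q n C) \<Longrightarrow>
      (\<forall>i \<in> ?N. g i \<noteq> \<one>\<^bsub>C\<^esub> \<longleftrightarrow> i \<in> A) \<Longrightarrow> f g = v A"
    by (metis PowI)
  define p where "p A i = (if i \<in> A then 1 - 1 / ?\<nu> else 1 / ?\<nu>)" for A and i :: nat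
  define q where "q A i = (if i \<in> A then - (1 - 1 / ?\<nu>) else 1 - 1 / ?\<nu>)" for A and i :: nat
  define w where "w A I = (\<Prod>i\<in>I. p A i) * (\<Prod>i\<in>?N - I. q A i)" for A I
  have f: "f g = (\<Sum>I\<in>Pow ?N. (\<Sum>A\<in>Pow ?N. v A * w A I) * nsupchar n C I g)"
    if g: "g \<in> carrier (Q n C)" for g
  proof -
    define B where "B = {i \<in> ?N. g i \<noteq> \<one>\<^bsub>C\<^esub>}"
    have gi: "g i \<in> carrier C" if "i \<in> ?N" for i
      using g that by (auto simp: carrier_Q[OF assms(1)])
    have ind: "(\<Sum>I\<in>Pow ?N. w A I * nsupchar n C I g) = (if A = B then 1 else 0)"
      if A: "A \<subseteq> ?N" for A
    proof -
      have "(\<Sum>I\<in>Pow ?N. w A I * nsupchar n C I g) =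
          (\<Sum>I\<in>Pow ?N. (\<Prod>i\<in>I. p A i) * (\<Prod>i\<in>?N - I. q A i * reg_bar C (g i)))"
      proof (intro sum.cong refl)
        fix I assume I: "I \<in> Pow ?N"
        have "nsupchar n C I g = (\<Prod>i\<in>?N. if i \<in> I then triv_char (g i) else reg_bar C (g i))"
          unfolding nsupchar_def tensor_def restrict_apply'[OF g] by (intro prod.cong) auto
        also have "\<dots> = (\<Prod>i\<in>?N - I. if i \<in> I then triv_char (g i) else reg_bar C (g i))"
          by (intro prod.mono_neutral_right) (auto simp: triv_char_def)
        also have "\<dots> = (\<Prod>i\<in>?N - I. reg_bar C (g i))" by (intro prod.cong) auto
        finally show "w A I * nsupchar n C I g =
            (\<Prod>i\<in>I. p A i) * (\<Prod>i\<in>?N - I. q A i * reg_bar C (g i))"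
          by (simp add: w_def prod.distrib mult.assoc)
      qed
      also have "\<dots> = (\<Prod>i\<in>?N. p A i + q A i * reg_bar C (g i))"
        by (rule prod_add[symmetric]) simp
      also have "\<dots> = (\<Prod>i\<in>?N. if i \<in> A \<longleftrightarrow> i \<in> B then 1 else 0)"
        using \<nu> by (intro prod.cong refl)
          (auto simp: p_def q_def B_def reg_bar_eq[OF assms(1,2) gi] field_simps)
      also have "\<dots> = (if A = B then 1 else 0)"
      proof (cases "A = B")
        case False
        then obtain i where "i \<in> ?N" "\<not> (i \<in> A \<longleftrightarrow> i \<in> B)"
          using A B_def by blast
        then have "(\<Prod>i\<in>?N. if i \<in> A \<longleftrightarrow> i \<in> B then 1 else (0::complex)) = 0"
          by (intro prod_zero) auto
        then show ?thesis using False by simp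
      qed simp
      finally show ?thesis .
    qed
    have ind': "v A * (\<Sum>I\<in>Pow ?N. w A I * nsupchar n C I g) = (if A = B then v A else 0)"
      if "A \<in> Pow ?N" for A
      using that by (simp only: ind Pow_iff) simp
    have "(\<Sum>I\<in>Pow ?N. (\<Sum>A\<in>Pow ?N. v A * w A I) * nsupchar n C I g) =
        (\<Sum>A\<in>Pow ?N. v A * (\<Sum>I\<in>Pow ?N. w A I * nsupchar n C I g))"
      unfolding sum_distrib_left sum_distrib_right mult.assoc by (rule sum.swap)
    also have "\<dots> = (\<Sum>A\<in>Pow ?N. if A = B then v A else 0)"
      by (intro sum.cong refl ind')
    also have "\<dots> = v B"
    proof -
      have "B \<in> Pow ?N" by (auto simp: B_def)
      then show ?thesis by (subst sum.delta) auto
    qed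
    also have "\<dots> = f g" by (rule v[symmetric]) (use g in \<open>auto simp: B_def\<close>)
    finally show ?thesis by simp
  qed
  show ?thesis
  proof (intro exI extensionalityI[of f "carrier (Q n C)"])
    show "f \<in> extensional (carrier (Q n C))" using assms(3) by (simp add: scf_def)
  qed (auto simp: f)
qed

lemma nsupchar_orthogonal:
  assumes "group C" "1 < Coset.order C" "I \<subseteq> {1..n - 1}" "J \<subseteq> {1..n - 1}"
  shows "(\<Sum>g\<in>carrier (Q n C). nsupchar n C I g * nsupchar n C J g) = 0 \<longleftrightarrow> I \<noteq> J"
proof -
  let ?N = "{1..n - 1}"
  let ?\<nu> = "of_nat (Coset.order C) :: complex"
  interpret group C by fact
  have fin: "finite (carrier C)" using assms(2) by (metis Coset.order_def card.infinite not_less_zero)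
  have card: "of_nat (card (carrier C - {\<one>\<^bsub>C\<^esub>})) = ?\<nu> - 1"
    using assms(2) by (simp add: Coset.order_def fin of_nat_diff)
  have \<nu>: "?\<nu> \<noteq> 0" "?\<nu> \<noteq> 1" using assms(2) by auto
  define \<phi> where "\<phi> I i = (if i \<in> I then triv_char else reg_bar C)" for I and i :: nat
  have split: "(\<Sum>x\<in>carrier C. h x) = h \<one>\<^bsub>C\<^esub> + (\<Sum>x\<in>carrier C - {\<one>\<^bsub>C\<^esub>}. h x)"
    for h :: "'a \<Rightarrow> complex" by (rule sum.remove[OF fin]) simp
  have r: "(\<Sum>x\<in>carrier C. reg_bar C x) = 0"
    "(\<Sum>x\<in>carrier C. reg_bar C x * reg_bar C x) = 1 + 1 / (?\<nu> - 1)"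
    using \<nu> unfolding split
    by (simp_all add: reg_bar_eq[OF assms(1,2)] card del: card_Diff_insert card_Diff_singleton)
  have r': "(\<Sum>x\<in>carrier C. reg_bar C x * reg_bar C x) \<noteq> 0"
    using \<nu> unfolding r(2) by (simp add: field_simps)
  have loc: "(\<Sum>x\<in>carrier C. \<phi> I i x * \<phi> J i x) = 0 \<longleftrightarrow> \<not> (i \<in> I \<longleftrightarrow> i \<in> J)" for i
    using r r' \<nu> by (auto simp: \<phi>_def triv_char_def Coset.order_def)
  have "(\<Sum>g\<in>carrier (Q n C). nsupchar n C I g * nsupchar n C J g) =
      (\<Sum>g\<in>carrier (Q n C). \<Prod>i\<in>?N. \<phi> I i (g i) * \<phi> J i (g i))"
    by (intro sum.cong refl) (simp add: nsupchar_def tensor_def \<phi>_def prod.distrib)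
  also have "\<dots> = (\<Prod>i\<in>?N. \<Sum>x\<in>carrier C. \<phi> I i x * \<phi> J i x)"
    unfolding carrier_Q[OF assms(1)] by (rule prod_sum_PiE[symmetric]) (use fin in auto)
  finally show ?thesis using assms(3,4) by (auto simp: loc)
qed

lemma nsupchar_coeff:
  assumes "group C" "1 < Coset.order C" "J \<subseteq> {1..n - 1}"
    and "\<And>g. g \<in> carrier (Q n C) \<Longrightarrow> f g = (\<Sum>I\<in>Pow {1..n - 1}. a I * nsupchar n C I g)"
  shows "(\<Sum>g\<in>carrier (Q n C). f g * nsupchar n C J g) /
    (\<Sum>g\<in>carrier (Q n C). nsupchar n C J g * nsupchar n C J g) = a J"
proof -
  let ?N = "{1..n - 1}" and ?d = "\<Sum>g\<in>carrier (Q n C). nsupchar n C J g * nsupchar n C J g"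
  have d: "?d \<noteq> 0" using nsupchar_orthogonal[OF assms(1,2,3,3)] by simp
  have "(\<Sum>g\<in>carrier (Q n C). f g * nsupchar n C J g) =
      (\<Sum>g\<in>carrier (Q n C). \<Sum>I\<in>Pow ?N. a I * (nsupchar n C I g * nsupchar n C J g))"
    by (intro sum.cong refl) (simp add: assms(4) sum_distrib_right mult.assoc)
  also have "\<dots> = (\<Sum>I\<in>Pow ?N. \<Sum>g\<in>carrier (Q n C). a I * (nsupchar n C I g * nsupchar n C J g))"
    by (rule sum.swap)
  also have "\<dots> = (\<Sum>I\<in>Pow ?N. if I = J then a J * ?d else 0)"
    unfolding sum_distrib_left[symmetric]
    using nsupchar_orthogonal[OF assms(1,2) _ assms(3)] by (intro sum.cong refl) auto
  also have "\<dots> = a J * ?d" using assms(3) by simp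
  finally show ?thesis using d by simp
qed


subsection \<open>Existence and uniqueness\<close>

lemma linear_sum:
  assumes lin: "\<And>f h a b. f \<in> scf n C \<Longrightarrow> h \<in> scf n C \<Longrightarrow>
      T (\<lambda>g \<in> carrier (Q n C). a * f g + b * h g) = (\<lambda>m. a * T f m + (b::complex) * T h m)"
    and "finite X" and F: "\<And>I. I \<in> X \<Longrightarrow> F I \<in> scf n C"
  shows "T (\<lambda>g \<in> carrier (Q n C). \<Sum>I\<in>X. a I * F I g) = (\<lambda>m. \<Sum>I\<in>X. a I * T (F I) m)"
  using assms(2) F
proof (induction X rule: finite_induct)
  case empty
  let ?z = "\<lambda>g \<in> carrier (Q n C). 0"
  have "?z \<in> scf n C" using sum_restrict_scf[of "{}"] by simp
  from lin[OF this this, of 0 0] show ?case by (simp add: restrict_def cong: if_cong)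
next
  case (insert J X)
  let ?s = "\<lambda>g \<in> carrier (Q n C). \<Sum>I\<in>X. a I * F I g"
  have s: "?s \<in> scf n C" by (rule sum_restrict_scf) (use insert in auto)
  have "(\<lambda>g \<in> carrier (Q n C). \<Sum>I\<in>insert J X. a I * F I g) =
      (\<lambda>g \<in> carrier (Q n C). a J * F J g + 1 * ?s g)"
    using insert.hyps by (intro restrict_ext) simp
  then have "T (\<lambda>g \<in> carrier (Q n C). \<Sum>I\<in>insert J X. a I * F I g) =
      (\<lambda>m. a J * T (F J) m + 1 * T ?s m)"
    using lin[OF insert.prems[of J] s, of "a J" 1] by simp
  also have "T ?s = (\<lambda>m. \<Sum>I\<in>X. a I * T (F I) m)" using insert by blast
  finally show ?case using insert.hyps by simp
qed

theorem ex1_is_ch: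
  assumes "group C" "1 < Coset.order C"
  shows "\<exists>!T. is_ch n C T"
proof (rule ex_ex1I)
  let ?X = "Pow {1..n - 1}" and ?S = "scf n C" and ?R = "carrier (Q n C)"
  define k where "k f I = (\<Sum>g\<in>?R. f g * nsupchar n C I g) /
    (\<Sum>g\<in>?R. nsupchar n C I g * nsupchar n C I g)" for f I
  have kcomb: "k f J = a J" if "J \<in> ?X" "f = (\<lambda>g \<in> ?R. \<Sum>I\<in>?X. a I * nsupchar n C I g)" for f a J
    unfolding k_def by (rule nsupchar_coeff[OF assms]) (use that in auto)
  have expand: "f = (\<lambda>g \<in> ?R. \<Sum>I\<in>?X. k f I * nsupchar n C I g)" if f: "f \<in> ?S" for f
  proof -
    obtain a where a: "f = (\<lambda>g \<in> ?R. \<Sum>I\<in>?X. a I * nsupchar n C I g)"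
      using scf_span[OF assms f] by blast
    also have "\<dots> = (\<lambda>g \<in> ?R. \<Sum>I\<in>?X. k f I * nsupchar n C I g)"
      using kcomb[OF _ a] by (intro restrict_ext sum.cong) auto
    finally show ?thesis .
  qed
  have comb: "(\<lambda>g \<in> ?R. \<Sum>I\<in>?X. a I * nsupchar n C I g) \<in> ?S" for a
    by (rule sum_restrict_scf) (rule nsupchar_scf[OF assms])
  define T where "T = (\<lambda>f \<in> ?S. (\<lambda>m. \<Sum>I\<in>?X. k f I * fundamental_qsym n I m))"
  have T: "T (\<lambda>g \<in> ?R. \<Sum>I\<in>?X. a I * nsupchar n C I g) =
      (\<lambda>m. \<Sum>I\<in>?X. a I * fundamental_qsym n I m)" for a
    unfolding T_def restrict_apply'[OF comb] using kcomb by (intro ext sum.cong) auto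
  have lin: "T (\<lambda>g \<in> ?R. a * f g + b * h g) = (\<lambda>m. a * T f m + b * T h m)"
    if f: "f \<in> ?S" and h: "h \<in> ?S" for f h a b
  proof -
    have "(\<lambda>g \<in> ?R. a * f g + b * h g) =
        (\<lambda>g \<in> ?R. \<Sum>I\<in>?X. (a * k f I + b * k h I) * nsupchar n C I g)"
      by (subst (1) expand[OF f], subst (1) expand[OF h], intro restrict_ext)
        (simp add: sum_distrib_left sum.distrib algebra_simps)
    then have "T (\<lambda>g \<in> ?R. a * f g + b * h g) =
        (\<lambda>m. \<Sum>I\<in>?X. (a * k f I + b * k h I) * fundamental_qsym n I m)"
      by (simp only: T)
    also have "\<dots> = (\<lambda>m. a * T f m + b * T h m)"
      unfolding T_def restrict_apply'[OF f] restrict_apply'[OF h]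
      by (simp add: sum_distrib_left sum.distrib algebra_simps)
    finally show ?thesis .
  qed
  have "inj_on T ?S"
  proof (rule inj_onI)
    fix f h assume f: "f \<in> ?S" and h: "h \<in> ?S" and eq: "T f = T h"
    have "k f I = k h I" if "I \<in> ?X" for I
    proof (rule fundamental_independent[where n = n and a = "k f" and b = "k h"])
      show "(\<lambda>m. \<Sum>I\<in>?X. k f I * fundamental_qsym n I m) =
          (\<lambda>m. \<Sum>I\<in>?X. k h I * fundamental_qsym n I m)"
        using eq f h by (simp only: T_def restrict_apply')
    qed (use that in blast)
    then have "(\<lambda>g \<in> ?R. \<Sum>I\<in>?X. k f I * nsupchar n C I g) =
        (\<lambda>g \<in> ?R. \<Sum>I\<in>?X. k h I * nsupchar n C I g)"
      by (intro restrict_ext sum.cong) auto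
    then show "f = h" using expand[OF f] expand[OF h] by simp
  qed
  moreover have "T ` ?S = QSym n"
  proof
    show "T ` ?S \<subseteq> QSym n" by (auto simp: T_def QSym_fundamental)
    show "QSym n \<subseteq> T ` ?S"
    proof
      fix F assume "F \<in> QSym n"
      then obtain b where "F = (\<lambda>m. \<Sum>I\<in>?X. b I * fundamental_qsym n I m)"
        unfolding QSym_fundamental by blast
      then have "F = T (\<lambda>g \<in> ?R. \<Sum>I\<in>?X. b I * nsupchar n C I g)" by (simp only: T)
      then show "F \<in> T ` ?S" using comb by (rule image_eqI)
    qed
  qed
  moreover have "T (nsupchar n C I) = fundamental_qsym n I" if "I \<subseteq> {1..n - 1}" for I
  proof -
    have d: "(\<Sum>J\<in>?X. (if J = I then 1 else 0) * F J) = F I" for F :: "nat set \<Rightarrow> complex"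
      using that by (simp add: if_distrib[of "\<lambda>x. x * _"] cong: if_cong)
    have "nsupchar n C I = (\<lambda>g \<in> ?R. \<Sum>J\<in>?X. (if J = I then 1 else 0) * nsupchar n C J g)"
      unfolding d by (rule extensional_restrict[symmetric]) (simp add: nsupchar_def tensor_def)
    then have "T (nsupchar n C I) = (\<lambda>m. \<Sum>J\<in>?X. (if J = I then 1 else 0) * fundamental_qsym n J m)"
      using T by simp
    then show ?thesis unfolding d by simp
  qed
  moreover have "T \<in> extensional ?S" by (simp add: T_def)
  ultimately have "is_ch n C T"
    unfolding is_ch_def bij_betw_def using lin by blast
  then show "\<exists>T. is_ch n C T" by (rule exI[of _ T])
next
  let ?X = "Pow {1..n - 1}" and ?S = "scf n C" and ?R = "carrier (Q n C)"
  fix T U assume TU: "is_ch n C T" "is_ch n C U"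
  show "T = U"
  proof (rule extensionalityI[of _ ?S])
    fix f assume f: "f \<in> ?S"
    obtain k where k: "f = (\<lambda>g \<in> ?R. \<Sum>I\<in>?X. k I * nsupchar n C I g)"
      using scf_span[OF assms f] by blast
    have ev: "V f = (\<lambda>m. \<Sum>I\<in>?X. k I * fundamental_qsym n I m)" if V: "is_ch n C V" for V
    proof -
      have linV: "V (\<lambda>g \<in> ?R. a * f g + b * h g) = (\<lambda>m. a * V f m + b * V h m)"
        if "f \<in> ?S" "h \<in> ?S" for f h a b
        using V that unfolding is_ch_def by blast
      have "V f = V (\<lambda>g \<in> ?R. \<Sum>I\<in>?X. k I * nsupchar n C I g)" using k by simp
      also have "\<dots> = (\<lambda>m. \<Sum>I\<in>?X. k I * V (nsupchar n C I) m)"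
        by (rule linear_sum[OF linV]) (simp_all add: nsupchar_scf[OF assms])
      also have "\<dots> = (\<lambda>m. \<Sum>I\<in>?X. k I * fundamental_qsym n I m)"
        using V by (intro ext sum.cong) (auto simp: is_ch_def)
      finally show ?thesis .
    qed
    show "T f = U f" using ev TU by simp
  qed (use TU in \<open>auto simp: is_ch_def\<close>)
qed

end

theory Submission
  imports Defs
begin

text \<open>
  Both sides have the same coordinates in the two bases that the characteristic map matches.  On
  the group side the function is a tensor product whose component at each \<open>i \<notin> I\<close> is the
  difference of the normalized regular character and \<open>\<nu>\<close> to the weight of \<open>i\<close>.  Multiplying out
  means choosing one of these two summands for each \<open>i \<notin> I\<close>.  If \<open>J\<close> consists of \<open>I\<close> and of the
  positions where the power of \<open>\<nu>\<close> is chosen, the resulting term is a scalar times the normalized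
  supercharacter of \<open>J\<close>: each \<open>i \<in> J - I\<close> contributes a sign, and the weights add up to the
  exponent in Hivert's definition (\<open>hl_function_expansion\<close>).  The characteristic map is linear and
  sends this supercharacter to the fundamental function of \<open>J\<close>, so Hivert's expansion at \<open>q = \<nu>\<close>
  appears term by term (\<open>specialize_hall_littlewood\<close>).
\<close>

lemma ch_is_ch:
  assumes "group C" "1 < Coset.order C"
  shows "is_ch n C (ch n C)"
  unfolding ch_def by (rule theI'[OF ex1_is_ch[OF assms]])

lemma poly_fundamental_qsym: "poly (fundamental_qsym n J m) q = fundamental_qsym n J m"
  by (simp add: fundamental_qsym_def monomial_qsym_def poly_sum)

lemma specialize_hall_littlewood:
  "specialize q (hall_littlewood n I) = (\<lambda>m. \<Sum>J | I \<subseteq> J \<and> J \<subseteq> {1..n - 1}.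
     (- 1) ^ card (J - I) * q ^ hivert_exponent I J * fundamental_qsym n J m)"
  by (simp add: specialize_def hall_littlewood_def poly_sum poly_monom poly_fundamental_qsym)

text \<open>
  A supercharacter is blind to the coordinates in its index set, where its factors are constantly
  1.  Hence the terms of the multiplied-out product are supercharacters again.
\<close>

lemma nsupchar_apply:
  assumes "g \<in> carrier (Q n C)"
  shows "nsupchar n C J g = (\<Prod>i\<in>{1..n - 1} - J. reg_bar C (g i))"
proof -
  have "nsupchar n C J g = (\<Prod>i\<in>{1..n - 1}. if i \<in> J then 1 else reg_bar C (g i))"
    using assms by (auto simp: nsupchar_def tensor_def triv_char_def intro!: prod.cong)
  also have "\<dots> = (\<Prod>i\<in>{1..n - 1} - J. reg_bar C (g i))"
    by (rule prod.mono_neutral_cong_right) auto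
  finally show ?thesis .
qed

lemma hl_function_apply:
  assumes "g \<in> carrier (Q n C)"
  shows "hl_function n C I g =
    (\<Prod>i\<in>{1..n - 1} - I. reg_bar C (g i) - of_nat (Coset.order C) ^ wt I i)"
proof -
  have "hl_function n C I g = (\<Prod>i\<in>{1..n - 1}. if i \<in> I then 1
      else reg_bar C (g i) - of_nat (Coset.order C) ^ wt I i)"
    using assms by (auto simp: hl_function_def tensor_def triv_char_def intro!: prod.cong)
  also have "\<dots> = (\<Prod>i\<in>{1..n - 1} - I. reg_bar C (g i) - of_nat (Coset.order C) ^ wt I i)"
    by (rule prod.mono_neutral_cong_right) auto
  finally show ?thesis .
qed

text \<open>
  The set \<open>K\<close> of positions where the power of \<open>\<nu>\<close> is chosen runs through the subsets of the
  complement of \<open>I\<close>; the substitution \<open>J = I \<union> K\<close> turns the sum into one over the supersets of \<open>I\<close>.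
\<close>

lemma hl_function_expansion:
  assumes I: "I \<subseteq> {1..n - 1}"
  shows "hl_function n C I = (\<lambda>g\<in>carrier (Q n C). \<Sum>J | I \<subseteq> J \<and> J \<subseteq> {1..n - 1}.
     (- 1) ^ card (J - I) * of_nat (Coset.order C) ^ hivert_exponent I J * nsupchar n C J g)"
proof (rule extensionalityI[of _ "carrier (Q n C)"])
  show "hl_function n C I \<in> extensional (carrier (Q n C))"
    by (simp add: hl_function_def tensor_def)
next
  fix g assume g: "g \<in> carrier (Q n C)"
  let ?N = "{1..n - 1}" and ?\<nu> = "of_nat (Coset.order C) :: complex"
  let ?T = "\<lambda>K R. (- 1) ^ card K * (\<Prod>i\<in>K. ?\<nu> ^ wt I i) * (\<Prod>i\<in>R. reg_bar C (g i))"
  have "hl_function n C I g = (\<Sum>K\<in>Pow (?N - I). ?T K (?N - I - K))"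
    unfolding hl_function_apply[OF g] by (rule prod_diff_conv_sum) simp
  also have "\<dots> = (\<Sum>J | I \<subseteq> J \<and> J \<subseteq> ?N. ?T (J - I) (?N - J))"
  proof (rule sum.reindex_bij_witness[of _ "\<lambda>J. J - I" "\<lambda>K. I \<union> K"])
    fix K assume "K \<in> Pow (?N - I)"
    then have "I \<union> K - I = K" "?N - (I \<union> K) = ?N - I - K" by auto
    then show "?T (I \<union> K - I) (?N - (I \<union> K)) = ?T K (?N - I - K)"
      by simp
  qed (use I in auto)
  also have "\<dots> = (\<Sum>J | I \<subseteq> J \<and> J \<subseteq> ?N.
      (- 1) ^ card (J - I) * ?\<nu> ^ hivert_exponent I J * nsupchar n C J g)"
    by (simp add: hivert_exponent_def power_sum nsupchar_apply[OF g])
  finally show "hl_function n C I g = (\<lambda>g\<in>carrier (Q n C). \<Sum>J | I \<subseteq> J \<and> J \<subseteq> ?N.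
      (- 1) ^ card (J - I) * ?\<nu> ^ hivert_exponent I J * nsupchar n C J g) g"
    using g by simp
qed simp

theorem proposition5p3:
  fixes n \<nu> :: nat and I :: "nat set" and C :: "'a monoid"
  assumes "group C" and "cyclic_group C" and "Coset.order C = \<nu>"
    and "\<nu> > 1"
    and "I \<subseteq> {1..n - 1}"
  shows "ch n C (hl_function n C I) = specialize (of_nat \<nu>) (hall_littlewood n I)"
proof -
  let ?X = "{J. I \<subseteq> J \<and> J \<subseteq> {1..n - 1}}"
  let ?c = "\<lambda>J. (- 1) ^ card (J - I) * of_nat \<nu> ^ hivert_exponent I J :: complex"
  have \<nu>: "1 < Coset.order C" using assms(3,4) by simp
  note ch = ch_is_ch[OF assms(1) \<nu>, of n]
  have lin: "ch n C (\<lambda>g\<in>carrier (Q n C). a * f g + b * h g) =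
      (\<lambda>m. a * ch n C f m + b * ch n C h m)"
    if "f \<in> scf n C" "h \<in> scf n C" for f h a b
    using ch that unfolding is_ch_def by blast
  have fin: "finite ?X" by (rule finite_subset[of _ "Pow {1..n - 1}"]) auto
  have "ch n C (hl_function n C I) = (\<lambda>m. \<Sum>J\<in>?X. ?c J * ch n C (nsupchar n C J) m)"
    unfolding hl_function_expansion[OF assms(5)] assms(3)
    by (rule linear_sum[OF lin fin nsupchar_scf[OF assms(1) \<nu>]])
  also have "\<dots> = (\<lambda>m. \<Sum>J\<in>?X. ?c J * fundamental_qsym n J m)"
    using ch by (intro ext sum.cong refl) (simp add: is_ch_def)
  finally show ?thesis unfolding specialize_hall_littlewood .
qed

end
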